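(* Let $X_\bullet$ denote an $\mathrm{FI}$--set finitely generated in degree $\leq d$. Then there exists a finite collection of integers $m_i \leq d$, and subgroups $H_i \subseteq \mathfrak{S}_{m_i}$, such that, for $n$ sufficiently large, we have an isomorphism \[ X_n \cong \bigsqcup_i \mathfrak{S}_n / (H_i \times \mathfrak{S}_{n-m_i}) \] as sets with an action of $\mathfrak{S}_n$.
   Context: $\mathrm{FI}$ is the category whose objects are the sets $[n]=\{1,\ldots,n\}$ and whose morphisms are injections. An $\mathrm{FI}$--set is a functor $X_\bullet$ from $\mathrm{FI}$ to finite sets, with $X_n$ its value on $[n]$; $\mathfrak{S}_n=\mathrm{Hom}_{\mathrm{FI}}([n],[n])$ acts on $X_n$. $X_\bullet$ is finitely generated in degree $\leq d$ if there is a finite subset of $\bigsqcup_{i\le d}X_i$ not contained in any proper $\mathrm{FI}$--subset. $\mathfrak{S}_n$ denotes the symmetric group on $n$ letters. *)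

theory Defs
  imports "HOL-Library.FuncSet" "HOL-Algebra.Sym_Groups" "HOL-Algebra.Left_Coset"
begin

text \<open>
  Morphisms from [m] to [n] are extensional functions, so that each injection has exactly one
  representative. The objects are indexed by all natural numbers, [0] being the empty set.
  Composition is \<^const>\<open>compose\<close>.
\<close>

definition FI_hom :: "nat \<Rightarrow> nat \<Rightarrow> (nat \<Rightarrow> nat) set" where
  "FI_hom m n = {f \<in> {1..m} \<rightarrow>\<^sub>E {1..n}. inj_on f {1..m}}"

text \<open>
  \<open>F m n f\<close> is the map from \<open>X m\<close> to \<open>X n\<close> induced by \<open>f \<in> FI_hom m n\<close>;
  only its values on \<open>X m\<close> are meaningful.
\<close>

locale FI_set =
  fixes X :: "nat \<Rightarrow> 'a set"
    and F :: "nat \<Rightarrow> nat \<Rightarrow> (nat \<Rightarrow> nat) \<Rightarrow> 'a \<Rightarrow> 'a"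
  assumes finite_values: "finite (X n)"
    and maps: "f \<in> FI_hom m n \<Longrightarrow> F m n f \<in> X m \<rightarrow> X n"
    and map_id: "x \<in> X n \<Longrightarrow> F n n (\<lambda>i\<in>{1..n}. i) x = x"
    and map_compose: "\<lbrakk>f \<in> FI_hom l m; g \<in> FI_hom m n; x \<in> X l\<rbrakk>
      \<Longrightarrow> F l n (compose {1..l} g f) x = F m n g (F l m f x)"

definition FI_subset ::
  "(nat \<Rightarrow> 'a set) \<Rightarrow> (nat \<Rightarrow> 'a set) \<Rightarrow> (nat \<Rightarrow> nat \<Rightarrow> (nat \<Rightarrow> nat) \<Rightarrow> 'a \<Rightarrow> 'a) \<Rightarrow> bool" where
  "FI_subset Y X F \<longleftrightarrow>
     (\<forall>n. Y n \<subseteq> X n) \<and> (\<forall>m n. \<forall>f\<in>FI_hom m n. F m n f ` Y m \<subseteq> Y n)"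

definition FI_finitely_generated ::
  "(nat \<Rightarrow> 'a set) \<Rightarrow> (nat \<Rightarrow> nat \<Rightarrow> (nat \<Rightarrow> nat) \<Rightarrow> 'a \<Rightarrow> 'a) \<Rightarrow> nat \<Rightarrow> bool" where
  "FI_finitely_generated X F d \<longleftrightarrow>
     (\<exists>S. finite S \<and> S \<subseteq> (SIGMA i:{..d}. X i) \<and>
       \<not> (\<exists>Y. FI_subset Y X F \<and> Y \<noteq> X \<and> S \<subseteq> (SIGMA i:UNIV. Y i)))"

text \<open>
  Elements of \<^const>\<open>sym_group\<close> are functions on all naturals fixing everything outside [n];
  restricting to [n] gives the corresponding endomorphism in \<^term>\<open>FI_hom n n\<close>.
\<close>

definition FI_sym_action ::
  "(nat \<Rightarrow> nat \<Rightarrow> (nat \<Rightarrow> nat) \<Rightarrow> 'a \<Rightarrow> 'a) \<Rightarrow> nat \<Rightarrow> (nat \<Rightarrow> nat) \<Rightarrow> 'a \<Rightarrow> 'a" where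
  "FI_sym_action F n \<sigma> = F n n (restrict \<sigma> {1..n})"

text \<open>
  For a subgroup \<open>H\<close> of the symmetric group on \<open>m\<close> letters and \<open>m \<le> n\<close>, this is the product of
  \<open>H\<close> with the symmetric group on \<open>n - m\<close> letters, as a subgroup of the symmetric group on \<open>n\<close>
  letters: \<open>H\<close> acts on \<open>{1..m}\<close> and the second factor on \<open>{m+1..n}\<close>.
\<close>

definition sym_product :: "nat \<Rightarrow> nat \<Rightarrow> (nat \<Rightarrow> nat) set \<Rightarrow> (nat \<Rightarrow> nat) set" where
  "sym_product m n H = {h \<circ> \<tau> | h \<tau>. h \<in> H \<and> \<tau> permutes {m+1..n}}"

definition equivariant_iso ::
  "('g, 'r) monoid_scheme \<Rightarrow> 'a set \<Rightarrow> ('g \<Rightarrow> 'a \<Rightarrow> 'a) \<Rightarrow> 'b set \<Rightarrow> ('g \<Rightarrow> 'b \<Rightarrow> 'b) \<Rightarrow> bool" where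
  "equivariant_iso G A \<alpha> B \<beta> \<longleftrightarrow>
     (\<exists>f. bij_betw f A B \<and> (\<forall>g\<in>carrier G. \<forall>x\<in>A. f (\<alpha> g x) = \<beta> g (f x)))"

end

theory Submission
  imports Defs
begin

text \<open>
  The set of orbits on \<open>X\<close> and on \<open>X \<times> X\<close> eventually stabilizes, so beyond some large \<open>N\<close> the maps
  induced by the inclusions are injective and bijective on orbits. Each orbit of \<open>X N\<close> contains an
  element \<open>x\<close> whose least support is \<open>{1..m}\<close> with \<open>m \<le> d\<close>. Let \<open>H\<close> be the stabilizer of \<open>x\<close> among the
  permutations of \<open>{1..m}\<close>. For \<open>n \<ge> N\<close> the least support of the image of \<open>x\<close> in \<open>X n\<close> is still \<open>{1..m}\<close>;
  the stabilizer preserves it and is therefore the product of \<open>H\<close> with the symmetric group on \<open>{m+1..n}\<close>.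
\<close>

section \<open>Permutations\<close>

text \<open>The images of \<open>f\<close> and \<open>g\<close> have equal size, hence so do their
  complements in the finite set \<open>A\<close>; any bijection of the complements completes the
  prescribed values.\<close>

lemma ex_permutes_extending:
  assumes "finite A" "inj_on f I" "inj_on g I" "f ` I \<subseteq> A" "g ` I \<subseteq> A"
  shows "\<exists>\<sigma>. \<sigma> permutes A \<and> (\<forall>i\<in>I. \<sigma> (f i) = g i)"
proof -
  have "card (f ` I) = card (g ` I)"
    using assms by (simp add: card_image)
  then have "card (A - f ` I) = card (A - g ` I)"
    using assms by (simp add: card_Diff_subset finite_subset)
  then obtain b where b: "bij_betw b (A - f ` I) (A - g ` I)"
    using assms(1) finite_same_card_bij by (metis finite_Diff)
  define \<sigma> where "\<sigma> x = (if x \<in> f ` I then g (inv_into I f x) else if x \<in> A then b x else x)" for x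
  have "bij_betw (g \<circ> inv_into I f) (f ` I) (g ` I)"
    using assms by (meson bij_betw_imageI bij_betw_inv_into bij_betw_trans)
  then have 1: "bij_betw \<sigma> (f ` I) (g ` I)"
    by (rule bij_betw_cong[THEN iffD1, rotated]) (simp add: \<sigma>_def)
  have 2: "bij_betw \<sigma> (A - f ` I) (A - g ` I)"
    by (rule bij_betw_cong[THEN iffD1, OF _ b]) (simp add: \<sigma>_def)
  have "bij_betw \<sigma> (f ` I \<union> (A - f ` I)) (g ` I \<union> (A - g ` I))"
    by (rule bij_betw_combine[OF 1 2]) auto
  moreover have "f ` I \<union> (A - f ` I) = A" "g ` I \<union> (A - g ` I) = A"
    using assms by auto
  ultimately have "bij_betw \<sigma> A A"
    by simp
  moreover have "\<sigma> x = x" if "x \<notin> A" for x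
    using that assms(4) by (auto simp: \<sigma>_def)
  ultimately have "\<sigma> permutes A"
    by (rule bij_imp_permutes)
  moreover have "\<sigma> (f i) = g i" if "i \<in> I" for i
    using that assms(2) by (simp add: \<sigma>_def)
  ultimately show ?thesis
    by blast
qed

text \<open>Symmetric groups on two sets sharing a point \<open>c\<close> generate the one on the
  union: each transposition through \<open>c\<close> lies in one of them, and conjugation yields the
  others. In the applications \<open>P\<close> says that a given element is fixed.\<close>

lemma permutes_Un_closure:
  assumes "finite A" "finite B" "c \<in> A" "c \<in> B"
    and A: "\<And>\<tau>. \<tau> permutes A \<Longrightarrow> P \<tau>" and B: "\<And>\<tau>. \<tau> permutes B \<Longrightarrow> P \<tau>"
    and comp: "\<And>\<sigma> \<tau>. \<sigma> permutes A \<union> B \<Longrightarrow> \<tau> permutes A \<union> B \<Longrightarrow> P \<sigma> \<Longrightarrow> P \<tau> \<Longrightarrow> P (\<sigma> \<circ> \<tau>)"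
    and \<sigma>: "\<sigma> permutes A \<union> B"
  shows "P \<sigma>"
proof -
  have c: "P (transpose a c)" if "a \<in> A \<union> B" for a
    using that A B assms(3,4) by (auto intro: permutes_swap_id)
  have transp: "P (transpose a b)" if "a \<in> A \<union> B" "b \<in> A \<union> B" for a b
  proof (cases "a = b \<or> a = c \<or> b = c")
    case True
    then show ?thesis
      using c[OF that(1)] c[OF that(2)] A[OF permutes_id] by (auto simp: transpose_commute)
  next
    case False
    then have "transpose a b = transpose a c \<circ> (transpose b c \<circ> transpose a c)"
      by (auto simp: fun_eq_iff transpose_def)
    then show ?thesis
      using c that assms(3) by (auto intro!: comp permutes_compose permutes_swap_id)
  qed
  have "finite (A \<union> B)"
    using assms by simp
  with \<sigma> show ?thesis
  proof (induction rule: permutes_induct)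
    case id
    then show ?case using A[OF permutes_id] by (simp add: id_def)
  next
    case (swap a b p)
    then show ?case
      using transp
      by (intro comp permutes_swap_id) auto
  qed
qed

text \<open>Let \<open>h\<close> be \<open>\<sigma>\<close> cut off outside \<open>T\<close>; then
  the inverse of \<open>h\<close> after \<open>\<sigma>\<close> fixes \<open>T\<close>
  pointwise.\<close>

lemma permutes_split_invariant:
  assumes "\<sigma> permutes A" "T \<subseteq> A" "\<sigma> ` T = T"
  shows "\<exists>h \<tau>. h permutes T \<and> \<tau> permutes A - T \<and> \<sigma> = h \<circ> \<tau>"
proof -
  define h where "h i = (if i \<in> T then \<sigma> i else i)" for i
  have "bij_betw \<sigma> T T"
    using assms by (metis bij_betw_imageI inj_on_subset permutes_inj subset_UNIV)
  then have "bij_betw h T T"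
    by (rule bij_betw_cong[THEN iffD1, rotated]) (simp add: h_def)
  then have h: "h permutes T"
    by (rule bij_imp_permutes) (simp add: h_def)
  have "(inv' h \<circ> \<sigma>) permutes A"
    using assms h by (meson permutes_compose permutes_inv permutes_subset)
  moreover have "(inv' h \<circ> \<sigma>) i = i" if "i \<in> T" for i
    using that h permutes_inverses(2)[OF h, of i] by (simp add: h_def)
  ultimately have "(inv' h \<circ> \<sigma>) permutes A - T"
    by (rule permutes_superset) auto
  moreover have "\<sigma> = h \<circ> (inv' h \<circ> \<sigma>)"
    using permutes_inverses(1)[OF h] by (auto simp: fun_eq_iff)
  ultimately show ?thesis
    using h by blast
qed

section \<open>Orbit decomposition\<close>

text \<open>Orbit-stabilizer for all orbits at once, with \<open>y\<close> picking one point in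
  each. A point goes to the set of all group elements carrying its representative to it, so no coset
  representative has to be chosen.\<close>

lemma equivariant_iso_orbits:
  assumes "group G"
    and closed: "\<And>g x. g \<in> carrier G \<Longrightarrow> x \<in> A \<Longrightarrow> \<alpha> g x \<in> A"
    and one: "\<And>x. x \<in> A \<Longrightarrow> \<alpha> \<one>\<^bsub>G\<^esub> x = x"
    and mult: "\<And>g h x. g \<in> carrier G \<Longrightarrow> h \<in> carrier G \<Longrightarrow> x \<in> A \<Longrightarrow> \<alpha> (g \<otimes>\<^bsub>G\<^esub> h) x = \<alpha> g (\<alpha> h x)"
    and y: "\<And>i. i \<in> I \<Longrightarrow> y i \<in> A"
    and cover: "\<And>x. x \<in> A \<Longrightarrow> \<exists>i\<in>I. \<exists>g\<in>carrier G. \<alpha> g (y i) = x"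
    and distinct: "\<And>i j g. i \<in> I \<Longrightarrow> j \<in> I \<Longrightarrow> g \<in> carrier G \<Longrightarrow> \<alpha> g (y i) = y j \<Longrightarrow> i = j"
    and K: "\<And>i. i \<in> I \<Longrightarrow> K i = {g \<in> carrier G. \<alpha> g (y i) = y i}"
  shows "equivariant_iso G A \<alpha> (SIGMA i:I. lcosets\<^bsub>G\<^esub> (K i)) (\<lambda>g (i, C). (i, g <#\<^bsub>G\<^esub> C))"
proof -
  interpret group G by fact
  \<comment> \<open>For fixed \<open>x\<close> in \<open>A\<close> this is a left coset of
    \<open>K i\<close> when \<open>i\<close> is the index of the orbit of \<open>x\<close>, and
    empty for every other \<open>i\<close> in \<open>I\<close>.\<close>
  define tr where "tr i x = {g \<in> carrier G. \<alpha> g (y i) = x}" for i x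
  have inv_act: "\<alpha> (inv\<^bsub>G\<^esub> g) (\<alpha> g x) = x" if "g \<in> carrier G" "x \<in> A" for g x
    using that by (metis inv_closed l_inv mult one)
  have tr_act: "tr i (\<alpha> g x) = g <#\<^bsub>G\<^esub> tr i x" if "i \<in> I" "g \<in> carrier G" "x \<in> A" for i g x
  proof (intro equalityI subsetI)
    fix h assume "h \<in> tr i (\<alpha> g x)"
    then have h: "h \<in> carrier G" "\<alpha> h (y i) = \<alpha> g x"
      by (auto simp: tr_def)
    then have "inv\<^bsub>G\<^esub> g \<otimes>\<^bsub>G\<^esub> h \<in> tr i x"
      using that y by (simp add: tr_def mult inv_act)
    moreover have "h = g \<otimes>\<^bsub>G\<^esub> (inv\<^bsub>G\<^esub> g \<otimes>\<^bsub>G\<^esub> h)"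
      using that h by (simp add: m_assoc[symmetric])
    ultimately show "h \<in> g <#\<^bsub>G\<^esub> tr i x"
      by (auto simp: l_coset_def)
  next
    fix h assume "h \<in> g <#\<^bsub>G\<^esub> tr i x"
    then show "h \<in> tr i (\<alpha> g x)"
      using that y by (auto simp: l_coset_def tr_def mult)
  qed
  have tr_y: "tr i (y i) = K i" if "i \<in> I" for i
    using K that by (auto simp: tr_def)
  define idx where "idx x = (SOME i. i \<in> I \<and> tr i x \<noteq> {})" for x
  have idx: "idx x \<in> I \<and> tr (idx x) x \<noteq> {}" if "x \<in> A" for x
  proof -
    have "\<exists>i. i \<in> I \<and> tr i x \<noteq> {}"
      using cover[OF that] unfolding tr_def by blast
    then show ?thesis
      unfolding idx_def by (rule someI_ex)
  qed
  have idx_eq: "idx (\<alpha> g (y i)) = i" if "i \<in> I" "g \<in> carrier G" for i g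
  proof -
    let ?j = "idx (\<alpha> g (y i))"
    have j: "?j \<in> I" "tr ?j (\<alpha> g (y i)) \<noteq> {}"
      using idx closed y that by blast+
    then obtain h where h: "h \<in> carrier G" "\<alpha> h (y ?j) = \<alpha> g (y i)"
      by (auto simp: tr_def)
    have "\<alpha> (inv\<^bsub>G\<^esub> g \<otimes>\<^bsub>G\<^esub> h) (y ?j) = y i"
      using h that y j by (simp add: mult inv_act)
    then show ?thesis
      using distinct[OF j(1) that(1)] h that by blast
  qed
  define f where "f x = (idx x, tr (idx x) x)" for x
  have f_act: "f (\<alpha> g (y i)) = (i, g <#\<^bsub>G\<^esub> K i)" if "i \<in> I" "g \<in> carrier G" for i g
    using that by (simp add: f_def idx_eq tr_act y tr_y)
  have "inj_on f A"
  proof (rule inj_onI)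
    fix x x' assume x: "x \<in> A" "x' \<in> A" "f x = f x'"
    have "tr (idx x) x = tr (idx x) x'"
      using x(3) unfolding f_def by (metis prod.inject)
    moreover obtain g where "g \<in> tr (idx x) x"
      using idx[OF x(1)] by blast
    ultimately have "g \<in> tr (idx x) x" "g \<in> tr (idx x) x'"
      by simp_all
    then show "x = x'"
      by (simp add: tr_def)
  qed
  moreover have "f ` A = (SIGMA i:I. lcosets\<^bsub>G\<^esub> (K i))"
  proof (intro equalityI subsetI)
    fix p assume "p \<in> f ` A"
    then obtain i g where "i \<in> I" "g \<in> carrier G" "p = f (\<alpha> g (y i))"
      using cover by (metis imageE)
    then show "p \<in> (SIGMA i:I. lcosets\<^bsub>G\<^esub> (K i))"
      by (auto simp: f_act LCOSETS_def)
  next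
    fix p assume "p \<in> (SIGMA i:I. lcosets\<^bsub>G\<^esub> (K i))"
    then obtain i g where "i \<in> I" "g \<in> carrier G" "p = (i, g <#\<^bsub>G\<^esub> K i)"
      by (auto simp: LCOSETS_def)
    then show "p \<in> f ` A"
      using f_act closed y by (metis image_eqI)
  qed
  moreover have "f (\<alpha> g x) = (\<lambda>(i, C). (i, g <#\<^bsub>G\<^esub> C)) (f x)" if "g \<in> carrier G" "x \<in> A" for g x
  proof -
    obtain i h where ih: "i \<in> I" "h \<in> carrier G" "x = \<alpha> h (y i)"
      using cover \<open>x \<in> A\<close> by blast
    have "idx (\<alpha> g x) = i" "idx x = i"
      using ih that idx_eq[of i "g \<otimes>\<^bsub>G\<^esub> h"] idx_eq[of i h] y by (auto simp: mult)
    then show ?thesis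
      using ih(1) that by (simp add: f_def tr_act)
  qed
  ultimately show ?thesis
    unfolding equivariant_iso_def bij_betw_def by blast
qed

section \<open>The action of injections\<close>

text \<open>A version of \<open>FI_hom\<close> without extensionality: \<open>id\<close>,
  permutations of the naturals and plain composites qualify directly, without
  \<open>restrict\<close> or \<open>compose\<close>.\<close>

definition embedding :: "nat \<Rightarrow> nat \<Rightarrow> (nat \<Rightarrow> nat) \<Rightarrow> bool" where
  "embedding m n f \<longleftrightarrow> inj_on f {1..m} \<and> f ` {1..m} \<subseteq> {1..n}"

lemma embedding_restrict: "embedding m n f \<Longrightarrow> restrict f {1..m} \<in> FI_hom m n"
  by (auto simp: embedding_def FI_hom_def inj_on_restrict_eq)

lemma FI_hom_embedding: "f \<in> FI_hom m n \<Longrightarrow> embedding m n f \<and> restrict f {1..m} = f"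
  by (auto simp: embedding_def FI_hom_def PiE_def extensional_restrict)

lemma embedding_id: "m \<le> n \<Longrightarrow> embedding m n id"
  by (auto simp: embedding_def)

lemma embedding_permutes: "\<sigma> permutes {1..n} \<Longrightarrow> embedding n n \<sigma>"
  by (auto simp: embedding_def permutes_inj_on permutes_image)

lemma embedding_comp: "embedding l m f \<Longrightarrow> embedding m n g \<Longrightarrow> embedding l n (g \<circ> f)"
  unfolding embedding_def by (auto intro: comp_inj_on inj_on_subset)

lemma embedding_extend:
  assumes "embedding m n f" "embedding m n' g" "n \<le> n'"
  shows "\<exists>\<sigma>. \<sigma> permutes {1..n'} \<and> (\<forall>i\<in>{1..m}. \<sigma> (f i) = g i)"
  by (rule ex_permutes_extending) (use assms in \<open>force simp: embedding_def\<close>)+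

context FI_set
begin

definition act :: "nat \<Rightarrow> nat \<Rightarrow> (nat \<Rightarrow> nat) \<Rightarrow> 'a \<Rightarrow> 'a" where
  "act m n f x = F m n (restrict f {1..m}) x"

lemma act_closed: "embedding m n f \<Longrightarrow> x \<in> X m \<Longrightarrow> act m n f x \<in> X n"
  using maps embedding_restrict by (fastforce simp: act_def)

lemma act_id: "x \<in> X n \<Longrightarrow> act n n id x = x"
  using map_id by (simp add: act_def id_def)

lemma act_cong: "(\<And>i. i \<in> {1..m} \<Longrightarrow> f i = g i) \<Longrightarrow> act m n f x = act m n g x"
  unfolding act_def by (metis restrict_ext)

lemma act_act:
  assumes "embedding l m f" "embedding m n g" "x \<in> X l"
  shows "act m n g (act l m f x) = act l n (g \<circ> f) x"
proof -
  have "compose {1..l} (restrict g {1..m}) (restrict f {1..l}) = restrict (g \<circ> f) {1..l}"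
    using assms(1) by (auto simp: compose_def embedding_def fun_eq_iff image_subset_iff)
  then show ?thesis
    using map_compose[OF embedding_restrict[OF assms(1)] embedding_restrict[OF assms(2)] assms(3)]
    by (simp add: act_def)
qed

text \<open>For \<open>m = n\<close> this is an orbit of the symmetric group. For
  \<open>m < n\<close> it is one too, by \<open>orb_act\<close> with \<open>id\<close>: that of the
  image of \<open>x\<close> under the inclusion.\<close>

definition orb :: "nat \<Rightarrow> nat \<Rightarrow> 'a \<Rightarrow> 'a set" where
  "orb m n x = {act m n f x | f. embedding m n f}"

text \<open>By \<open>embedding_extend\<close>, every embedding of \<open>{1..m}\<close> into
  \<open>{1..n'}\<close> agrees on \<open>{1..m}\<close> with a permutation after
  \<open>f\<close>.\<close>

lemma orb_act:
  assumes f: "embedding m n f" and "n \<le> n'" and x: "x \<in> X m"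
  shows "orb n n' (act m n f x) = orb m n' x"
proof (intro equalityI subsetI)
  fix z assume "z \<in> orb n n' (act m n f x)"
  then show "z \<in> orb m n' x"
    using act_act[OF f _ x] embedding_comp[OF f] by (auto simp: orb_def)
next
  fix z assume "z \<in> orb m n' x"
  then obtain g where g: "embedding m n' g" "z = act m n' g x"
    by (auto simp: orb_def)
  obtain \<sigma> where \<sigma>: "\<sigma> permutes {1..n'}" "\<forall>i\<in>{1..m}. \<sigma> (f i) = g i"
    using embedding_extend[OF f g(1) \<open>n \<le> n'\<close>] by blast
  have "embedding n n' \<sigma>"
    using embedding_comp[OF embedding_id[OF \<open>n \<le> n'\<close>] embedding_permutes[OF \<sigma>(1)]] by simp
  moreover have "act m n' (\<sigma> \<circ> f) x = act m n' g x"
    by (rule act_cong) (use \<sigma>(2) in simp)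
  then have "z = act n n' \<sigma> (act m n f x)"
    by (simp add: act_act[OF f \<open>embedding n n' \<sigma>\<close> x] g(2))
  ultimately show "z \<in> orb n n' (act m n f x)"
    by (auto simp: orb_def)
qed

lemma self_in_orb: "x \<in> X n \<Longrightarrow> x \<in> orb n n x"
  unfolding orb_def using act_id embedding_id by (metis (mono_tags, lifting) le_refl mem_Collect_eq)

lemma in_orb_iff: "z \<in> orb n n x \<longleftrightarrow> (\<exists>\<sigma>. \<sigma> permutes {1..n} \<and> z = act n n \<sigma> x)"
proof
  assume "z \<in> orb n n x"
  then obtain f where f: "embedding n n f" "z = act n n f x"
    by (auto simp: orb_def)
  obtain \<sigma> where \<sigma>: "\<sigma> permutes {1..n}" "\<forall>i\<in>{1..n}. \<sigma> (id i) = f i"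
    using embedding_extend[OF embedding_id[OF order_refl] f(1) order_refl] by blast
  have "act n n f x = act n n \<sigma> x"
    by (rule act_cong) (use \<sigma>(2) in simp)
  then have "z = act n n \<sigma> x"
    using f(2) by simp
  then show "\<exists>\<sigma>. \<sigma> permutes {1..n} \<and> z = act n n \<sigma> x"
    using \<sigma>(1) by blast
qed (use embedding_permutes in \<open>auto simp: orb_def\<close>)

section \<open>Generation in bounded degree and stability of orbits\<close>

definition generated_in_degree :: "nat \<Rightarrow> bool" where
  "generated_in_degree d \<longleftrightarrow>
     (\<forall>n. \<forall>x\<in>X n. \<exists>m s f. m \<le> d \<and> s \<in> X m \<and> embedding m n f \<and> x = act m n f s)"

lemma generated_in_degreeE:
  assumes "generated_in_degree d" "x \<in> X n"
  obtains m s f where "m \<le> d" "s \<in> X m" "embedding m n f" "x = act m n f s"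
  using assms unfolding generated_in_degree_def by blast

text \<open>The images of \<open>S\<close> under all embeddings form an FI-subset containing
  \<open>S\<close>, hence exhaust \<open>X\<close>.\<close>

lemma finitely_generated_in_degree:
  assumes "FI_finitely_generated X F d"
  shows "generated_in_degree d"
proof -
  obtain S where S: "S \<subseteq> (SIGMA i:{..d}. X i)"
    "\<And>Y. FI_subset Y X F \<Longrightarrow> S \<subseteq> (SIGMA i:UNIV. Y i) \<Longrightarrow> Y = X"
    using assms unfolding FI_finitely_generated_def by blast
  define Y where "Y n = {act m n f s | m f s. (m, s) \<in> S \<and> embedding m n f}" for n
  have "FI_subset Y X F"
    unfolding FI_subset_def
  proof (intro conjI allI ballI subsetI)
    fix n x assume "x \<in> Y n"
    then show "x \<in> X n"
      using S(1) by (auto simp: Y_def intro!: act_closed)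
  next
    fix m n g x assume g: "g \<in> FI_hom m n" and "x \<in> F m n g ` Y m"
    then obtain l f s where *: "(l, s) \<in> S" "embedding l m f" "x = F m n g (act l m f s)"
      by (auto simp: Y_def)
    have "x = act l n (g \<circ> f) s"
      using FI_hom_embedding[OF g] * S(1) act_act[of l m f n g s] by (auto simp: act_def)
    moreover have "embedding l n (g \<circ> f)"
      using FI_hom_embedding[OF g] *(2) embedding_comp by blast
    ultimately show "x \<in> Y n"
      using *(1) by (auto simp: Y_def)
  qed
  moreover have "S \<subseteq> (SIGMA i:UNIV. Y i)"
  proof (rule subrelI)
    fix m s assume "(m, s) \<in> S"
    moreover from this have "s = act m m id s"
      using S(1) act_id by (auto simp: act_id)
    ultimately show "(m, s) \<in> (SIGMA i:UNIV. Y i)"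
      using embedding_id[of m m] unfolding Y_def by blast
  qed
  ultimately have "Y = X"
    by (rule S(2))
  show ?thesis
    unfolding generated_in_degree_def
  proof (intro allI ballI)
    fix n x assume "x \<in> X n"
    then have "x \<in> Y n"
      using \<open>Y = X\<close> by simp
    then show "\<exists>m s f. m \<le> d \<and> s \<in> X m \<and> embedding m n f \<and> x = act m n f s"
      using S(1) by (force simp: Y_def)
  qed
qed

text \<open>
  In degrees at least \<open>d\<close> the inclusions are surjective on orbits, so the number of orbits does
  not increase; once it is constant, the inclusions are injective on orbits.
\<close>

lemma orbits_eventually_injective:
  assumes gen: "generated_in_degree d"
  obtains N where "\<And>n n' x y. N \<le> n \<Longrightarrow> n \<le> n' \<Longrightarrow> x \<in> X n \<Longrightarrow> y \<in> X n \<Longrightarrow>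
    orb n n' x = orb n n' y \<Longrightarrow> orb n n x = orb n n y"
proof -
  define orbs where "orbs n = orb n n ` X n" for n
  \<comment> \<open>The map on orbits induced by the inclusion, written as a union so that no
    representative is chosen.\<close>
  define p where "p n n' Z = (\<Union>z\<in>Z. orb n n' z)" for n n' Z
  have p_orb: "p n n' (orb n n x) = orb n n' x" if "n \<le> n'" "x \<in> X n" for n n' x
  proof -
    have *: "orb n n' z = orb n n' x" if "z \<in> orb n n x" for z
    proof -
      obtain f where f: "embedding n n f" "z = act n n f x"
        using \<open>z \<in> orb n n x\<close> unfolding orb_def by blast
      show ?thesis
        unfolding f(2) by (rule orb_act[OF f(1) \<open>n \<le> n'\<close> \<open>x \<in> X n\<close>])
    qed
    show ?thesis
      unfolding p_def by (rule SUP_eq_const[OF _ *]) (use self_in_orb[OF that(2)] in blast)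
  qed
  have surj: "p n n' ` orbs n = orbs n'" if "d \<le> n" "n \<le> n'" for n n'
  proof (intro equalityI subsetI)
    fix Z assume "Z \<in> p n n' ` orbs n"
    then obtain x where x: "x \<in> X n" "Z = orb n n' x"
      using p_orb[OF \<open>n \<le> n'\<close>] by (auto simp: orbs_def)
    have "Z = orb n' n' (act n n' id x)"
      using orb_act[OF embedding_id order_refl] x \<open>n \<le> n'\<close> by simp
    then show "Z \<in> orbs n'"
      using act_closed[OF embedding_id] x(1) \<open>n \<le> n'\<close> by (auto simp: orbs_def)
  next
    fix Z assume "Z \<in> orbs n'"
    then obtain x where x: "x \<in> X n'" "Z = orb n' n' x"
      by (auto simp: orbs_def)
    obtain m s f where s: "m \<le> d" "s \<in> X m" "embedding m n' f" "x = act m n' f s"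
      using generated_in_degreeE[OF gen x(1)] .
    \<comment> \<open>As \<open>m \<le> d \<le> n\<close>, the generator \<open>s\<close> can be
      placed in \<open>X n\<close> first; its orbit there maps to \<open>Z\<close>.\<close>
    have m: "embedding m n id"
      using s(1) that embedding_id by simp
    have "Z = p n n' (orb n n (act m n id s))"
      using p_orb[OF \<open>n \<le> n'\<close> act_closed[OF m s(2)]] orb_act[OF m \<open>n \<le> n'\<close> s(2)]
        orb_act[OF s(3) order_refl s(2)] x(2) s(4) by simp
    then show "Z \<in> p n n' ` orbs n"
      using act_closed[OF m s(2)] by (auto simp: orbs_def)
  qed
  have fin: "finite (orbs n)" for n
    using finite_values by (simp add: orbs_def)
  \<comment> \<open>A degree with the fewest orbits among those at least \<open>d\<close>. By
    surjectivity later degrees have no more, so the number is constant from \<open>N\<close>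
    on.\<close>
  obtain N where N: "d \<le> N" "\<And>n. d \<le> n \<Longrightarrow> card (orbs N) \<le> card (orbs n)"
    using ex_has_least_nat[of "\<lambda>n. d \<le> n" d "\<lambda>n. card (orbs n)"] by auto
  have const: "card (orbs n) = card (orbs N)" if "N \<le> n" for n
  proof (rule antisym)
    show "card (orbs n) \<le> card (orbs N)"
      using surj[OF N(1) that] card_image_le[OF fin] by metis
    show "card (orbs N) \<le> card (orbs n)"
      using N that by simp
  qed
  have inj: "inj_on (p n n') (orbs n)" if "N \<le> n" "n \<le> n'" for n n'
    using surj[of n n'] const[of n] const[of n'] that N(1) fin by (intro eq_card_imp_inj_on) auto
  show thesis
  proof (rule that)
    fix n n' x y
    assume "N \<le> n" "n \<le> n'" "x \<in> X n" "y \<in> X n" "orb n n' x = orb n n' y"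
    then show "orb n n x = orb n n y"
      using inj_onD[OF inj[of n n'], of "orb n n x" "orb n n y"] by (auto simp: p_orb orbs_def)
  qed
qed

section \<open>The FI-set of pairs and injectivity of the inclusions\<close>

lemma square_FI_set: "FI_set (\<lambda>n. X n \<times> X n) (\<lambda>m n f. map_prod (F m n f) (F m n f))"
  using finite_values maps
  by unfold_locales (auto simp: map_id map_compose Pi_iff simp del: One_nat_def)

lemma act_square:
  "FI_set.act (\<lambda>m n f. map_prod (F m n f) (F m n f)) m n f (x, y) = (act m n f x, act m n f y)"
  by (simp add: FI_set.act_def[OF square_FI_set] act_def)

text \<open>The coordinates come from embeddings whose images have at most \<open>d\<close> points
  each. Both factor through an enumeration of the union of these images, whence
  \<open>2 * d\<close>.\<close>

lemma square_generated_in_degree: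
  assumes gen: "generated_in_degree d"
  shows "FI_set.generated_in_degree (\<lambda>n. X n \<times> X n) (\<lambda>m n f. map_prod (F m n f) (F m n f)) (2 * d)"
  unfolding FI_set.generated_in_degree_def[OF square_FI_set]
proof (intro allI ballI)
  fix n p assume "p \<in> X n \<times> X n"
  then obtain x y where p: "p = (x, y)" "x \<in> X n" "y \<in> X n"
    by auto
  obtain m s f where s: "m \<le> d" "s \<in> X m" "embedding m n f" "x = act m n f s"
    using generated_in_degreeE[OF gen p(2)] .
  obtain m' s' f' where s': "m' \<le> d" "s' \<in> X m'" "embedding m' n f'" "y = act m' n f' s'"
    using generated_in_degreeE[OF gen p(3)] .
  define A where "A = f ` {1..m} \<union> f' ` {1..m'}"
  have "card A \<le> m + m'"
    unfolding A_def by (rule order_trans[OF card_Un_le]) (metis add_mono card_atLeastAtMost card_image_le diff_Suc_1 finite_atLeastAtMost)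
  then have "card A \<le> 2 * d"
    using s(1) s'(1) by simp
  obtain h where h: "bij_betw h {1..card A} A"
    using finite_same_card_bij[of "{1..card A}" A] by (auto simp: A_def)
  have emb: "embedding (card A) n h"
    using h s(3) s'(3) by (auto simp: bij_betw_def embedding_def A_def)
  have factor: "\<exists>t. t \<in> X (card A) \<and> act l n g z = act (card A) n h t"
    if "embedding l n g" "g ` {1..l} \<subseteq> A" "z \<in> X l" for l g z
  proof -
    define k where "k = inv_into {1..card A} h \<circ> g"
    have *: "inv_into {1..card A} h ` A = {1..card A}" "inj_on (inv_into {1..card A} h) A"
      using bij_betw_inv_into[OF h] by (auto simp: bij_betw_def)
    have k: "embedding l (card A) k"
      using * that(1,2) unfolding embedding_def k_def
      by (metis comp_inj_on image_comp image_mono inj_on_subset)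
    have "act (card A) n h (act l (card A) k z) = act l n (h \<circ> k) z"
      by (rule act_act[OF k emb that(3)])
    also have "\<dots> = act l n g z"
      using that(2) bij_betw_inv_into_right[OF h] by (intro act_cong) (auto simp: k_def image_subset_iff)
    finally show ?thesis
      using act_closed[OF k that(3)] by metis
  qed
  obtain t t' where "t \<in> X (card A)" "t' \<in> X (card A)"
    "x = act (card A) n h t" "y = act (card A) n h t'"
    using factor[OF s(3) _ s(2)] factor[OF s'(3) _ s'(2)] s(4) s'(4) by (auto simp: A_def)
  then show "\<exists>m s f. m \<le> 2 * d \<and> s \<in> X m \<times> X m \<and> embedding m n f \<and>
      p = FI_set.act (\<lambda>m n f. map_prod (F m n f) (F m n f)) m n f s"
    using \<open>card A \<le> 2 * d\<close> emb p(1)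
    by (intro exI[of _ "card A"] exI[of _ "(t, t')"] exI[of _ h]) (simp add: act_square)
qed

text \<open>
  Applying stability of orbits to \<open>X \<times> X\<close> gives injectivity of the inclusions for free: if \<open>x\<close> and
  \<open>y\<close> become equal, then \<open>(x, y)\<close> and \<open>(x, x)\<close> end up in the same orbit.
\<close>

lemma eventually_injective:
  assumes gen: "generated_in_degree d"
  obtains N where
    "\<And>n n' x y. N \<le> n \<Longrightarrow> n \<le> n' \<Longrightarrow> x \<in> X n \<Longrightarrow> y \<in> X n \<Longrightarrow>
      act n n' id x = act n n' id y \<Longrightarrow> x = y"
    "\<And>n n' x y. N \<le> n \<Longrightarrow> n \<le> n' \<Longrightarrow> x \<in> X n \<Longrightarrow> y \<in> X n \<Longrightarrow>
      orb n n' x = orb n n' y \<Longrightarrow> orb n n x = orb n n y"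
proof -
  interpret sq: FI_set "\<lambda>n. X n \<times> X n" "\<lambda>m n f. map_prod (F m n f) (F m n f)"
    by (rule square_FI_set)
  obtain N where N: "\<And>n n' p q. N \<le> n \<Longrightarrow> n \<le> n' \<Longrightarrow> p \<in> X n \<times> X n \<Longrightarrow> q \<in> X n \<times> X n \<Longrightarrow>
      sq.orb n n' p = sq.orb n n' q \<Longrightarrow> sq.orb n n p = sq.orb n n q"
    by (rule sq.orbits_eventually_injective[OF square_generated_in_degree[OF gen]]) (erule that)
  obtain N' where N': "\<And>n n' x y. N' \<le> n \<Longrightarrow> n \<le> n' \<Longrightarrow> x \<in> X n \<Longrightarrow> y \<in> X n \<Longrightarrow>
      orb n n' x = orb n n' y \<Longrightarrow> orb n n x = orb n n y"
    by (rule orbits_eventually_injective[OF gen]) (erule that)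
  have "x = y" if *: "N \<le> n" "n \<le> n'" "x \<in> X n" "y \<in> X n" "act n n' id x = act n n' id y" for n n' x y
  proof -
    have "sq.orb n n' (x, y) = sq.orb n' n' (act n n' id x, act n n' id y)"
      using sq.orb_act[OF embedding_id[OF *(2)] order_refl, of "(x, y)"] * by (simp add: act_square)
    also have "\<dots> = sq.orb n n' (x, x)"
      using sq.orb_act[OF embedding_id[OF *(2)] order_refl, of "(x, x)"] * by (simp add: act_square)
    finally have "sq.orb n n (x, y) = sq.orb n n (x, x)"
      using N * by simp
    \<comment> \<open>Every element of the orbit of \<open>(x, x)\<close> has equal
      coordinates.\<close>
    then have "(x, y) \<in> sq.orb n n (x, x)"
      using sq.self_in_orb[of "(x, y)" n] * by simp
    then show ?thesis
      by (auto simp: sq.orb_def act_square)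
  qed
  then show thesis
    using N' by (intro that[of "max N N'"]) (meson max.boundedE)+
qed

section \<open>Supports\<close>

text \<open>Support in the sense of nominal sets: the permutations tested are those of
  \<open>{1..n}\<close> that fix \<open>T\<close> pointwise.\<close>

definition supports :: "nat \<Rightarrow> nat set \<Rightarrow> 'a \<Rightarrow> bool" where
  "supports n T x \<longleftrightarrow> (\<forall>\<tau>. \<tau> permutes {1..n} - T \<longrightarrow> act n n \<tau> x = x)"

lemma permutes_act_act:
  assumes "\<sigma> permutes {1..n}" "\<tau> permutes {1..n}" "x \<in> X n"
  shows "act n n \<sigma> (act n n \<tau> x) = act n n (\<sigma> \<circ> \<tau>) x"
  using assms act_act embedding_permutes by blast

lemma act_inclusion:
  assumes "\<sigma> permutes {1..n}" "n \<le> n'" "x \<in> X n"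
  shows "act n' n' \<sigma> (act n n' id x) = act n n' id (act n n \<sigma> x)"
proof -
  have "embedding n' n' \<sigma>"
    using assms by (intro embedding_permutes permutes_subset[OF assms(1)]) auto
  then show ?thesis
    using act_act[OF embedding_id[OF assms(2)] _ assms(3)]
      act_act[OF embedding_permutes[OF assms(1)] embedding_id[OF assms(2)] assms(3)] by simp
qed

text \<open>The complements of \<open>T\<close> and \<open>U\<close> share a point, so
  \<open>permutes_Un_closure\<close> applies. Such a point matters: for \<open>n = 2\<close> both
  \<open>{1}\<close> and \<open>{2}\<close> support every element, while the empty set need
  not.\<close>

lemma supports_Int:
  assumes "supports n T x" "supports n U x" "x \<in> X n" "\<not> {1..n} \<subseteq> T \<union> U"
  shows "supports n (T \<inter> U) x"
  unfolding supports_def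
proof (intro allI impI)
  obtain c where c: "c \<in> {1..n}" "c \<notin> T" "c \<notin> U"
    using assms(4) by blast
  fix \<tau> assume "\<tau> permutes {1..n} - T \<inter> U"
  then have "\<tau> permutes ({1..n} - T) \<union> ({1..n} - U)"
    by (simp add: Diff_Int)
  then show "act n n \<tau> x = x"
  proof (rule permutes_Un_closure[where c = c, rotated -1])
    fix \<sigma> \<rho> assume *: "\<sigma> permutes ({1..n} - T) \<union> ({1..n} - U)" "\<rho> permutes ({1..n} - T) \<union> ({1..n} - U)"
      "act n n \<sigma> x = x" "act n n \<rho> x = x"
    have "\<sigma> permutes {1..n}" "\<rho> permutes {1..n}"
      using *(1,2) by (auto elim!: permutes_subset)
    then show "act n n (\<sigma> \<circ> \<rho>) x = x"
      using permutes_act_act *(3,4) assms(3) by metis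
  qed (use c assms(1,2) in \<open>auto simp: supports_def\<close>)
qed

lemma supports_act:
  assumes "supports n T x" "\<sigma> permutes {1..n}" "x \<in> X n"
  shows "supports n (\<sigma> ` T) (act n n \<sigma> x)"
  unfolding supports_def
proof (intro allI impI)
  fix \<tau> assume \<tau>: "\<tau> permutes {1..n} - \<sigma> ` T"
  then have \<tau>': "\<tau> permutes {1..n}"
    by (auto elim: permutes_subset)
  let ?\<rho> = "inv' \<sigma> \<circ> (\<tau> \<circ> \<sigma>)"
  have \<rho>: "?\<rho> permutes {1..n}"
    using \<tau>' assms(2) by (intro permutes_compose permutes_inv)
  moreover have "?\<rho> i = i" if "i \<in> T" for i
    using that \<tau> assms(2) by (simp add: permutes_def[of \<tau>] permutes_inverses)
  ultimately have "?\<rho> permutes {1..n} - T"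
    by (rule permutes_superset) auto
  then have "act n n ?\<rho> x = x"
    using assms(1) by (simp add: supports_def)
  moreover have "\<sigma> \<circ> ?\<rho> = \<tau> \<circ> \<sigma>"
    using permutes_inverses(1)[OF assms(2)] by (auto simp: fun_eq_iff)
  ultimately show "act n n \<tau> (act n n \<sigma> x) = act n n \<sigma> x"
    using permutes_act_act[OF assms(2) \<rho> assms(3)] permutes_act_act[OF \<tau>' assms(2,3)] by simp
qed

text \<open>Here \<open>\<tau> \<circ> f\<close> agrees with \<open>f\<close> on
  \<open>{1..m}\<close>. With generation in degree at most \<open>d\<close> this provides supports
  of size at most \<open>d\<close>.\<close>

lemma supports_image:
  assumes "embedding m n f" "s \<in> X m"
  shows "supports n (f ` {1..m}) (act m n f s)"
  unfolding supports_def
proof (intro allI impI)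
  fix \<tau> assume \<tau>: "\<tau> permutes {1..n} - f ` {1..m}"
  then have "\<tau> permutes {1..n}"
    by (auto elim: permutes_subset)
  then have "act n n \<tau> (act m n f s) = act m n (\<tau> \<circ> f) s"
    using assms embedding_permutes act_act by blast
  also have "\<dots> = act m n f s"
    using \<tau> by (intro act_cong) (auto simp: permutes_def)
  finally show "act n n \<tau> (act m n f s) = act m n f s" .
qed

text \<open>The smallest support is normalized to \<open>{1..m}\<close> to match
  \<open>sym_product\<close>, where \<open>H\<close> acts on \<open>{1..m}\<close>.\<close>

definition minimally_supported :: "nat \<Rightarrow> nat \<Rightarrow> 'a \<Rightarrow> bool" where
  "minimally_supported N m x \<longleftrightarrow>
     supports N {1..m} x \<and> (\<forall>T. T \<subseteq> {1..N} \<longrightarrow> supports N T x \<longrightarrow> m \<le> card T)"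

text \<open>Take a support of least cardinality, which is at most \<open>d\<close> by
  \<open>supports_image\<close>, and move it to an initial segment by a permutation.\<close>

lemma ex_minimally_supported:
  assumes gen: "generated_in_degree d" and x: "x \<in> X N"
  shows "\<exists>y m. y \<in> orb N N x \<and> m \<le> d \<and> minimally_supported N m y"
proof -
  obtain l s f where s: "l \<le> d" "s \<in> X l" "embedding l N f" "x = act l N f s"
    using generated_in_degreeE[OF gen x] .
  let ?P = "\<lambda>T. T \<subseteq> {1..N} \<and> supports N T x"
  have A: "?P (f ` {1..l})"
    using s supports_image by (auto simp: embedding_def)
  then obtain T where T: "?P T" "\<And>U. ?P U \<Longrightarrow> card T \<le> card U"
    using ex_has_least_nat[of ?P "f ` {1..l}" card] by blast
  let ?m = "card T"
  have "?m \<le> l"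
    using T(2)[OF A] card_image_le[of "{1..l}" f] by simp
  have finT: "finite T"
    using T(1) finite_subset by blast
  then obtain h where h: "bij_betw h {1..?m} T"
    using finite_same_card_bij[of "{1..?m}" T] by auto
  have mN: "?m \<le> N"
    using T(1) card_mono[of "{1..N}" T] by simp
  obtain \<sigma> where \<sigma>: "\<sigma> permutes {1..N}" "\<forall>i\<in>{1..?m}. \<sigma> (h i) = id i"
    using embedding_extend[of ?m N h N id] h T(1) embedding_id[OF mN]
    by (auto simp: embedding_def bij_betw_def)
  have "T = h ` {1..?m}"
    using h by (simp add: bij_betw_def)
  then have \<sigma>T: "\<sigma> ` T = {1..?m}"
    using \<sigma>(2) by (metis (no_types, lifting) id_apply image_cong image_ident image_image)
  have x': "act N N (inv' \<sigma>) (act N N \<sigma> x) = x"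
    using permutes_act_act[OF permutes_inv[OF \<sigma>(1)] \<sigma>(1) x] permutes_inv_o(2)[OF \<sigma>(1)] act_id[OF x]
    by simp
  have "minimally_supported N ?m (act N N \<sigma> x)"
    unfolding minimally_supported_def
  proof (intro conjI allI impI)
    show "supports N {1..?m} (act N N \<sigma> x)"
      using supports_act[OF _ \<sigma>(1) x, of T] T(1) \<sigma>T by simp
    fix U assume U: "U \<subseteq> {1..N}" "supports N U (act N N \<sigma> x)"
    \<comment> \<open>A support of the moved element is carried back to a support of
      \<open>x\<close> that is no larger, so the choice of \<open>T\<close> applies.\<close>
    have inv: "inv' \<sigma> permutes {1..N}"
      using \<sigma>(1) by (rule permutes_inv)
    have "supports N (inv' \<sigma> ` U) x"
      using supports_act[OF U(2) inv act_closed[OF embedding_permutes[OF \<sigma>(1)] x]] x' by simp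
    moreover have "inv' \<sigma> ` U \<subseteq> {1..N}"
      using U(1) permutes_image[OF inv] by blast
    ultimately have "?m \<le> card (inv' \<sigma> ` U)"
      using T(2) by blast
    also have "\<dots> \<le> card U"
      using U(1) by (intro card_image_le) (rule finite_subset, auto)
    finally show "?m \<le> card U" .
  qed
  moreover have "act N N \<sigma> x \<in> orb N N x"
    using \<sigma>(1) in_orb_iff by blast
  ultimately show ?thesis
    using \<open>?m \<le> l\<close> s(1) by (meson le_trans)
qed

text \<open>
  The bound \<open>2 * d < N\<close> ensures that two supports of size at most \<open>d\<close> miss a common point, so that
  their intersection is a support and minimal supports are least ones.
\<close>

lemma supports_inclusion:
  assumes gen: "generated_in_degree d" and "2 * d < N" "N \<le> n" "m \<le> d"
    and x: "x \<in> X N" and min: "minimally_supported N m x"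
  shows "supports n {1..m} (act N n id x)"
  unfolding supports_def
proof (intro allI impI)
  obtain l s f where s: "l \<le> d" "s \<in> X l" "embedding l N f" "x = act l N f s"
    using generated_in_degreeE[OF gen x] .
  \<comment> \<open>By \<open>supports_image\<close>, \<open>A\<close> supports \<open>x\<close> in
    degree \<open>N\<close> and also its image in degree \<open>n\<close>; this controls
    permutations that move points beyond \<open>N\<close>.\<close>
  define A where "A = f ` {1..l}"
  have A: "finite A" "card A \<le> d" "A \<subseteq> {1..N}"
    using s(1,3) card_image_le[of "{1..l}" f] by (auto simp: A_def embedding_def)
  have x': "act N n id x = act l n f s"
    using act_act[OF s(3) embedding_id[OF \<open>N \<le> n\<close>] s(2)] s(4) by simp
  have "\<exists>c\<in>{1..N}. c \<notin> {1..m} \<and> c \<notin> A"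
  proof (rule ccontr)
    assume "\<not> ?thesis"
    then have "card {1..N} \<le> card ({1..m} \<union> A)"
      using A by (intro card_mono) auto
    then show False
      using card_Un_le[of "{1..m}" A] A(2) assms(2,4) by simp
  qed
  then obtain c where c: "c \<in> {1..N}" "c \<notin> {1..m}" "c \<notin> A"
    by blast
  \<comment> \<open>The point \<open>c\<close> avoids both sets, so the intersection is a support;
    minimality of \<open>m\<close> then forces \<open>{1..m}\<close> into \<open>A\<close>.\<close>
  have "supports N ({1..m} \<inter> A) x"
    using min supports_image[OF s(3,2)] s(4) x c
    by (intro supports_Int) (unfold minimally_supported_def A_def, blast+)
  then have "m \<le> card ({1..m} \<inter> A)"
    using min A(3) unfolding minimally_supported_def by blast
  then have "{1..m} \<inter> A = {1..m}"
    by (intro card_seteq) auto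
  then have mA: "{1..m} \<subseteq> A"
    by blast
  fix \<tau> assume "\<tau> permutes {1..n} - {1..m}"
  \<comment> \<open>Permutations of the first piece fix \<open>x\<close> already in degree
    \<open>N\<close>, those of the second fix its image because \<open>A\<close> is a support, and
    the pieces share \<open>c\<close>.\<close>
  moreover have "{1..n} - {1..m} = ({1..N} - {1..m}) \<union> ({1..n} - A)"
    using mA A(3) \<open>N \<le> n\<close> by auto
  ultimately have "\<tau> permutes ({1..N} - {1..m}) \<union> ({1..n} - A)"
    by simp
  then show "act n n \<tau> (act N n id x) = act N n id x"
  proof (rule permutes_Un_closure[where c = c, rotated -1])
    fix \<sigma> assume "\<sigma> permutes {1..N} - {1..m}"
    moreover from this have "\<sigma> permutes {1..N}"
      by (auto elim: permutes_subset)
    ultimately show "act n n \<sigma> (act N n id x) = act N n id x"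
      using act_inclusion[OF _ \<open>N \<le> n\<close> x] min by (simp add: minimally_supported_def supports_def)
  next
    fix \<sigma> assume "\<sigma> permutes {1..n} - A"
    moreover have "embedding l n f"
      using embedding_comp[OF s(3) embedding_id[OF \<open>N \<le> n\<close>]] by simp
    ultimately show "act n n \<sigma> (act N n id x) = act N n id x"
      using supports_image s(2) x' by (auto simp: supports_def A_def)
  next
    fix \<sigma> \<rho>
    assume *: "\<sigma> permutes ({1..N} - {1..m}) \<union> ({1..n} - A)" "\<rho> permutes ({1..N} - {1..m}) \<union> ({1..n} - A)"
      "act n n \<sigma> (act N n id x) = act N n id x" "act n n \<rho> (act N n id x) = act N n id x"
    have "\<sigma> permutes {1..n}" "\<rho> permutes {1..n}"
      using *(1,2) \<open>N \<le> n\<close> by (auto elim!: permutes_subset)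
    then show "act n n (\<sigma> \<circ> \<rho>) (act N n id x) = act N n id x"
      using permutes_act_act *(3,4) act_closed[OF embedding_id[OF \<open>N \<le> n\<close>] x] by metis
  qed (use c \<open>N \<le> n\<close> in auto)
qed

section \<open>Stabilizers of minimally supported elements\<close>

definition stabilizer_in :: "nat \<Rightarrow> nat \<Rightarrow> 'a \<Rightarrow> (nat \<Rightarrow> nat) set" where
  "stabilizer_in N m x = {h. h permutes {1..m} \<and> act N N h x = x}"

lemma subgroup_stabilizer_in:
  assumes "m \<le> N" "x \<in> X N"
  shows "subgroup (stabilizer_in N m x) (sym_group m)"
proof -
  have N: "h permutes {1..N}" if "h permutes {1..m}" for h
    using that assms(1) by (auto elim: permutes_subset)
  interpret group "sym_group m"
    by (rule sym_group_is_group)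
  show ?thesis
  proof (rule subgroupI)
    show "stabilizer_in N m x \<subseteq> carrier (sym_group m)"
      by (auto simp: stabilizer_in_def sym_group_carrier)
    show "stabilizer_in N m x \<noteq> {}"
      using act_id[OF assms(2)] permutes_id unfolding stabilizer_in_def by blast
  next
    fix h assume "h \<in> stabilizer_in N m x"
    then have h: "h permutes {1..m}" "act N N h x = x"
      by (auto simp: stabilizer_in_def)
    have "act N N (inv' h) x = x"
      using permutes_act_act[OF permutes_inv[OF N[OF h(1)]] N[OF h(1)] assms(2)]
        permutes_inv_o(2)[OF h(1)] act_id[OF assms(2)] h(2) by simp
    then show "inv\<^bsub>sym_group m\<^esub> h \<in> stabilizer_in N m x"
      using h(1) by (simp add: stabilizer_in_def sym_group_inv_equality sym_group_carrier permutes_inv)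
  next
    fix g h assume "g \<in> stabilizer_in N m x" "h \<in> stabilizer_in N m x"
    then show "g \<otimes>\<^bsub>sym_group m\<^esub> h \<in> stabilizer_in N m x"
      using permutes_act_act[OF N N assms(2), of g h]
      by (auto simp: stabilizer_in_def sym_group_mult permutes_compose)
  qed
qed

text \<open>A permutation fixing the image of \<open>x\<close> carries the support
  \<open>{1..m}\<close> to another support. The intersection of the two also supports
  \<open>x\<close>, by injectivity of the inclusion, so minimality makes the permutation preserve
  \<open>{1..m}\<close> and split. The converse combines the support property with equivariance of
  the inclusion.\<close>

lemma sym_product_stabilizer:
  assumes gen: "generated_in_degree d" and "2 * d < N" "N \<le> n" "m \<le> d"
    and x: "x \<in> X N" and min: "minimally_supported N m x"
    and inj: "\<And>y z. y \<in> X N \<Longrightarrow> z \<in> X N \<Longrightarrow> act N n id y = act N n id z \<Longrightarrow> y = z"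
  shows "sym_product m n (stabilizer_in N m x)
    = {\<sigma> \<in> carrier (sym_group n). act n n \<sigma> (act N n id x) = act N n id x}"
proof (intro equalityI subsetI)
  let ?y = "act N n id x"
  have y: "?y \<in> X n"
    using act_closed[OF embedding_id[OF \<open>N \<le> n\<close>] x] .
  have supp: "supports n {1..m} ?y"
    using supports_inclusion[OF assms(1-6)] .
  have diff: "{1..n} - {1..m} = {m+1..n}"
    by auto
  have N: "h permutes {1..N}" and n: "h permutes {1..n}" if "h permutes {1..m}" for h
    using that assms(2-4) by (auto elim: permutes_subset)
  {
    fix \<sigma> assume "\<sigma> \<in> sym_product m n (stabilizer_in N m x)"
    then obtain h \<tau> where *: "\<sigma> = h \<circ> \<tau>" "h permutes {1..m}" "act N N h x = x" "\<tau> permutes {m+1..n}"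
      by (auto simp: sym_product_def stabilizer_in_def)
    have \<tau>: "\<tau> permutes {1..n}"
      using *(4) by (auto elim: permutes_subset)
    have "act n n \<tau> ?y = ?y"
      using supp *(4) diff by (simp add: supports_def)
    moreover have "act n n h ?y = ?y"
      using act_inclusion[OF N[OF *(2)] \<open>N \<le> n\<close> x] *(3) by simp
    ultimately show "\<sigma> \<in> {\<sigma> \<in> carrier (sym_group n). act n n \<sigma> ?y = ?y}"
      using permutes_act_act[OF n[OF *(2)] \<tau> y] *(1) permutes_compose[OF \<tau> n[OF *(2)]]
      by (simp add: sym_group_carrier)
  next
    fix \<sigma> assume "\<sigma> \<in> {\<sigma> \<in> carrier (sym_group n). act n n \<sigma> ?y = ?y}"
    then have \<sigma>: "\<sigma> permutes {1..n}" "act n n \<sigma> ?y = ?y"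
      by (auto simp: sym_group_carrier)
    have cardI: "card (\<sigma> ` {1..m}) = m"
      using \<sigma>(1) by (simp add: card_image permutes_inj_on)
    let ?T = "{1..m} \<inter> \<sigma> ` {1..m}"
    \<comment> \<open>Both sets have \<open>m \<le> d\<close> points, while
      \<open>n \<ge> N > 2 * d\<close>.\<close>
    have "\<not> {1..n} \<subseteq> {1..m} \<union> \<sigma> ` {1..m}"
    proof
      assume "{1..n} \<subseteq> {1..m} \<union> \<sigma> ` {1..m}"
      then have "card {1..n} \<le> card ({1..m} \<union> \<sigma> ` {1..m})"
        by (intro card_mono) auto
      then show False
        using card_Un_le[of "{1..m}" "\<sigma> ` {1..m}"] cardI assms(2-4) by simp
    qed
    then have T: "supports n ?T ?y"
      using supp supports_act[OF supp \<sigma>(1) y] \<sigma>(2) y by (intro supports_Int) auto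
    \<comment> \<open>Descent to degree \<open>N\<close>: such a permutation of
      \<open>{1..N}\<close> fixes the image of \<open>x\<close>, hence \<open>x\<close> itself by
      \<open>inj\<close>.\<close>
    have "supports N ?T x"
      unfolding supports_def
    proof (intro allI impI)
      fix \<tau> assume \<tau>: "\<tau> permutes {1..N} - ?T"
      then have \<tau>N: "\<tau> permutes {1..N}" and "\<tau> permutes {1..n} - ?T"
        using \<open>N \<le> n\<close> by (auto elim!: permutes_subset)
      then have "act N n id (act N N \<tau> x) = act N n id x"
        using T act_inclusion[OF \<tau>N \<open>N \<le> n\<close> x] by (simp add: supports_def)
      then show "act N N \<tau> x = x"
        using inj act_closed[OF embedding_permutes[OF \<tau>N] x] x by blast
    qed
    moreover have "?T \<subseteq> {1..N}"
      using assms(2,4) by auto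
    ultimately have "m \<le> card ?T"
      using min by (auto simp: minimally_supported_def)
    then have "?T = {1..m}" "?T = \<sigma> ` {1..m}"
      using cardI by (intro card_seteq; simp)+
    then have "\<sigma> ` {1..m} = {1..m}"
      by simp
    moreover have "{1..m} \<subseteq> {1..n}"
      using assms(2-4) by auto
    ultimately obtain h \<tau> where h: "h permutes {1..m}" "\<tau> permutes {1..n} - {1..m}" "\<sigma> = h \<circ> \<tau>"
      using permutes_split_invariant[OF \<sigma>(1)] by blast
    have \<tau>: "\<tau> permutes {1..n}"
      using h(2) by (auto elim: permutes_subset)
    \<comment> \<open>Since \<open>\<sigma>\<close> and \<open>\<tau>\<close> fix \<open>?y\<close>,
      so does \<open>h\<close>; injectivity brings this back to \<open>x\<close>.\<close>
    have "act n n h ?y = act n n h (act n n \<tau> ?y)"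
      using supp h(2) by (simp add: supports_def)
    also have "\<dots> = ?y"
      using permutes_act_act[OF n[OF h(1)] \<tau> y] \<sigma>(2) h(3) by simp
    finally have "act N n id (act N N h x) = act N n id x"
      using act_inclusion[OF N[OF h(1)] \<open>N \<le> n\<close> x] by simp
    then have "act N N h x = x"
      using inj act_closed[OF embedding_permutes[OF N[OF h(1)]] x] x by blast
    then show "\<sigma> \<in> sym_product m n (stabilizer_in N m x)"
      using h diff by (auto simp: sym_product_def stabilizer_in_def)
  }
qed

section \<open>The decomposition in all large degrees\<close>

lemma ex_orbit_decomposition:
  assumes gen: "generated_in_degree d"
  shows "\<exists>(k::nat) (m :: nat \<Rightarrow> nat) (H :: nat \<Rightarrow> (nat \<Rightarrow> nat) set).
    (\<forall>i<k. m i \<le> d \<and> subgroup (H i) (sym_group (m i))) \<and>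
    (\<forall>\<^sub>F n in sequentially.
      equivariant_iso (sym_group n) (X n) (FI_sym_action F n)
        (SIGMA i:{..<k}. lcosets\<^bsub>sym_group n\<^esub> (sym_product (m i) n (H i)))
        (\<lambda>\<sigma> (i, C). (i, \<sigma> <#\<^bsub>sym_group n\<^esub> C)))"
proof -
  obtain N0 where N0: "\<And>n n' x y. N0 \<le> n \<Longrightarrow> n \<le> n' \<Longrightarrow> x \<in> X n \<Longrightarrow> y \<in> X n \<Longrightarrow>
      act n n' id x = act n n' id y \<Longrightarrow> x = y"
    "\<And>n n' x y. N0 \<le> n \<Longrightarrow> n \<le> n' \<Longrightarrow> x \<in> X n \<Longrightarrow> y \<in> X n \<Longrightarrow>
      orb n n' x = orb n n' y \<Longrightarrow> orb n n x = orb n n y"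
    by (rule eventually_injective[OF gen]) (erule that, assumption)
  \<comment> \<open>Past \<open>N0\<close> the inclusions are injective on elements and on orbits;
    exceeding \<open>2 * d\<close> leaves a point outside any two supports of size at most
    \<open>d\<close>.\<close>
  define N where "N = max N0 (2 * d + 1)"
  have N: "N0 \<le> N" "2 * d < N" "d \<le> N"
    by (auto simp: N_def)
  \<comment> \<open>The orbits in this one degree index the decomposition for every
    \<open>n \<ge> N\<close>.\<close>
  define Os where "Os = orb N N ` X N"
  define k where "k = card Os"
  have "finite Os"
    using finite_values by (simp add: Os_def)
  then obtain e where e: "bij_betw e {..<k} Os"
    using finite_same_card_bij[of "{..<k}" Os] by (auto simp: k_def)
  have "\<exists>x m. x \<in> X N \<and> orb N N x = e i \<and> m \<le> d \<and> minimally_supported N m x" if i: "i < k" for i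
  proof -
    obtain z where z: "z \<in> X N" "e i = orb N N z"
      using bij_betwE[OF e] i by (auto simp: Os_def)
    obtain x m where x: "x \<in> orb N N z" "m \<le> d" "minimally_supported N m x"
      using ex_minimally_supported[OF gen z(1)] by blast
    then obtain f where "embedding N N f" "x = act N N f z"
      by (auto simp: orb_def)
    then show ?thesis
      using x z act_closed orb_act[OF _ order_refl z(1)] by metis
  qed
  then obtain x m where xm: "\<And>i. i < k \<Longrightarrow> x i \<in> X N" "\<And>i. i < k \<Longrightarrow> orb N N (x i) = e i"
    "\<And>i. i < k \<Longrightarrow> m i \<le> d" "\<And>i. i < k \<Longrightarrow> minimally_supported N (m i) (x i)"
    by metis
  have iso: "equivariant_iso (sym_group n) (X n) (FI_sym_action F n)
      (SIGMA i:{..<k}. lcosets\<^bsub>sym_group n\<^esub> (sym_product (m i) n (stabilizer_in N (m i) (x i))))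
      (\<lambda>\<sigma> (i, C). (i, \<sigma> <#\<^bsub>sym_group n\<^esub> C))" if n: "N \<le> n" for n
  proof (rule equivariant_iso_orbits)
    have action: "FI_sym_action F n \<sigma> = act n n \<sigma>" for \<sigma>
      by (simp add: FI_sym_action_def act_def fun_eq_iff)
    have incl: "embedding N n id"
      using n by (rule embedding_id)
    define y where "y i = act N n id (x i)" for i
    show y: "y i \<in> X n" if "i \<in> {..<k}" for i
      using that xm(1) act_closed[OF incl] by (simp add: y_def)
    have orb_y: "orb n n (y i) = orb N n (x i)" if "i < k" for i
      using orb_act[OF incl order_refl xm(1)[OF that]] by (simp add: y_def)
    show "group (sym_group n)"
      by (rule sym_group_is_group)
    show "FI_sym_action F n g z \<in> X n" if "g \<in> carrier (sym_group n)" "z \<in> X n" for g z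
      using that by (simp add: action sym_group_carrier act_closed embedding_permutes del: One_nat_def)
    show "FI_sym_action F n \<one>\<^bsub>sym_group n\<^esub> z = z" if "z \<in> X n" for z
      using that by (simp add: action sym_group_one act_id)
    show "FI_sym_action F n (g \<otimes>\<^bsub>sym_group n\<^esub> h) z = FI_sym_action F n g (FI_sym_action F n h z)"
      if "g \<in> carrier (sym_group n)" "h \<in> carrier (sym_group n)" "z \<in> X n" for g h z
      using that by (simp add: action sym_group_carrier sym_group_mult permutes_act_act)
    show "\<exists>i\<in>{..<k}. \<exists>g\<in>carrier (sym_group n). FI_sym_action F n g (y i) = z" if z: "z \<in> X n" for z
    proof -
      obtain l s f where s: "l \<le> d" "s \<in> X l" "embedding l n f" "z = act l n f s"
        using generated_in_degreeE[OF gen z] .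
      \<comment> \<open>The generator \<open>s\<close> has degree at most \<open>d \<le> N\<close>,
        so it has an image in \<open>X N\<close>; the orbit of that image gives the index.\<close>
      have l: "embedding l N id"
        using s(1) N(3) embedding_id by simp
      let ?w = "act l N id s"
      have w: "?w \<in> X N"
        using act_closed[OF l s(2)] .
      then have "orb N N ?w \<in> e ` {..<k}"
        using bij_betw_imp_surj_on[OF e] by (simp add: Os_def)
      then obtain i where i: "i < k" "e i = orb N N ?w"
        by auto
      then have "?w \<in> orb N N (x i)"
        using xm(2) self_in_orb[OF w] by simp
      then obtain g where g: "embedding N N g" "?w = act N N g (x i)"
        unfolding orb_def by blast
      have "orb N n ?w = orb N n (x i)"
        unfolding g(2) by (rule orb_act[OF g(1) n xm(1)[OF i(1)]])
      then have "orb n n z = orb n n (y i)"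
        using orb_y[OF i(1)] orb_act[OF l n s(2)] orb_act[OF s(3) order_refl s(2)] s(4) by simp
      then have "z \<in> orb n n (y i)"
        using self_in_orb[OF z] by simp
      then show ?thesis
        using i(1) unfolding in_orb_iff action sym_group_carrier Bex_def by blast
    qed
    show "i = j" if "i \<in> {..<k}" "j \<in> {..<k}" "g \<in> carrier (sym_group n)"
      "FI_sym_action F n g (y i) = y j" for i j g
    proof -
      have "embedding n n g"
        using that(3) by (simp add: sym_group_carrier embedding_permutes)
      \<comment> \<open>Orbits that coincide in degree \<open>n\<close> coincide in degree
        \<open>N\<close>, where \<open>e\<close> numbers them without repetition.\<close>
      then have "orb n n (y j) = orb n n (y i)"
        using orb_act[OF _ order_refl y[OF that(1)], of n g] that(4) by (simp add: action)
      then have "orb N N (x i) = orb N N (x j)"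
        using N0(2)[OF N(1) n xm(1) xm(1), of i j] orb_y that(1,2) by simp
      then show "i = j"
        using xm(2) that(1,2) bij_betw_imp_inj_on[OF e] by (auto dest: inj_onD)
    qed
    show "sym_product (m i) n (stabilizer_in N (m i) (x i))
        = {g \<in> carrier (sym_group n). FI_sym_action F n g (y i) = y i}" if "i \<in> {..<k}" for i
      unfolding action y_def using that N0(1)[OF N(1) n]
      by (intro sym_product_stabilizer[OF gen N(2) n xm(3) xm(1) xm(4)]) auto
  qed
  have "m i \<le> d \<and> subgroup (stabilizer_in N (m i) (x i)) (sym_group (m i))" if "i < k" for i
    using that xm(1,3) N(3) by (meson le_trans subgroup_stabilizer_in)
  moreover have "\<forall>\<^sub>F n in sequentially. equivariant_iso (sym_group n) (X n) (FI_sym_action F n)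
      (SIGMA i:{..<k}. lcosets\<^bsub>sym_group n\<^esub> (sym_product (m i) n (stabilizer_in N (m i) (x i))))
      (\<lambda>\<sigma> (i, C). (i, \<sigma> <#\<^bsub>sym_group n\<^esub> C))"
    using iso eventually_sequentially by blast
  ultimately show ?thesis
    by (intro exI[of _ k] exI[of _ m] exI[of _ "\<lambda>i. stabilizer_in N (m i) (x i)"]) blast
qed

end

theorem theoremA:
  fixes X :: "nat \<Rightarrow> 'a set"
    and F :: "nat \<Rightarrow> nat \<Rightarrow> (nat \<Rightarrow> nat) \<Rightarrow> 'a \<Rightarrow> 'a"
    and d :: nat
  assumes "FI_set X F"
    and "FI_finitely_generated X F d"
  shows "\<exists>(k::nat) (m :: nat \<Rightarrow> nat) (H :: nat \<Rightarrow> (nat \<Rightarrow> nat) set).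
    (\<forall>i<k. m i \<le> d \<and> subgroup (H i) (sym_group (m i))) \<and>
    (\<forall>\<^sub>F n in sequentially.
      equivariant_iso (sym_group n)
        (X n) (FI_sym_action F n)
        (SIGMA i:{..<k}. lcosets\<^bsub>sym_group n\<^esub> (sym_product (m i) n (H i)))
        (\<lambda>\<sigma> (i, C). (i, \<sigma> <#\<^bsub>sym_group n\<^esub> C)))"
proof -
  interpret FI_set X F by fact
  show ?thesis
    using ex_orbit_decomposition[OF finitely_generated_in_degree[OF assms(2)]] .
qed

end
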